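(* Let $\mathcal{C}=\mathrm{Corridor}(u,l,D)$ be an $\mathbb{R}^m$-corridor and let $X\subset D$ be a finite set. Then the optimal value of problem $(\mathcal{R})$ for $(\mathcal{C},X)$, i.e. the minimum number of subsets in a partition of $X$ all of whose subsets are linearly compatible for $\mathcal{C}$, is a lower bound on the optimal value of the Corridor Fitting Problem in $\mathbb{R}^m$ on $\mathcal{C}$, i.e. on the minimum number of pieces of a piecewise linear function $g$ with domain $D$ satisfying $l(x)\le g(x)\le u(x)$ for all $x\in D$.
   Context: "Linear function" means affine function $x\mapsto a^Tx+b$ with $a\in\mathbb{R}^m$, $b\in\mathbb{R}$. Polytopes are compact; $\mathrm{int}$, $\mathrm{bd}$ and $\mathrm{conv}$ denote interior, boundary and convex hull. Corridor: let $D\subset\mathbb{R}^m$ be a full-dimensional polytope and $u,l:D\to\mathbb{R}$ continuous functions with $l(x)<u(x)$ for all $x\in D$. The $\mathbb{R}^m$-corridor between $u$ and $l$ of domain $D$ is $\mathrm{Corridor}(u,l,D)=\{(x,z)\in\mathbb{R}^{m+1} : x\in D,\ l(x)\le z\le u(x)\}$ (given together with the data $u,l,D$). Piecewise linear function with $n$ pieces and domain $D$ ($n\ge 1$ an integer): given full-dimensional polytopes $D_1,\dots,D_n\subset\mathbb{R}^m$ covering $D$ with pairwise disjoint interiors, and linear functions $l_i:D_i\to\mathbb{R}$, it is the function $g$ on $D$ with $g(x)=l_i(x)$ if $x\in\mathrm{int}(D_i)$, and, if $x$ lies on the boundary of some $D_i$, $g(x)=\min\{l_i(x): i \text{ with }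 x\in D_i\}$. Corridor Fitting Problem in $\mathbb{R}^m$ ($\mathbb{R}^m$-CFP) on $\mathrm{Corridor}(u,l,D)$: find a piecewise linear function $g$ with domain $D$ with the minimum number $n$ of pieces subject to $l(x)\le g(x)\le u(x)$ for all $x\in D$. Its optimal value is this minimum number of pieces. Linearly compatible set: a finite set $s\subset D$ is linearly compatible (for $\mathrm{Corridor}(u,l,D)$) if there is a linear function $L$ with $l(x)\le L(x)\le u(x)$ for all $x\in\mathrm{conv}(s)$; otherwise it is not linearly compatible. Problem $(\mathcal{R})$: given the corridor and a finite $X\subset D$, partition $X$ into a minimum number of subsets subject to each subset being linearly compatible. *)

theory Defs
  imports "HOL-Analysis.Analysis"
begin

definition full_dim_polytope :: "'a::euclidean_space set \<Rightarrow> bool" where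
  "full_dim_polytope S \<longleftrightarrow> polytope S \<and> aff_dim S = int DIM('a)"

text \<open>``Linear'' is meant in the affine sense. Functions on a domain \<open>D\<close> are total HOL functions
  of which only the values on \<open>D\<close> are used.\<close>

definition linear_function :: "('a::euclidean_space \<Rightarrow> real) \<Rightarrow> bool" where
  "linear_function L \<longleftrightarrow> (\<exists>a b. \<forall>x. L x = a \<bullet> x + b)"

text \<open>A corridor is represented by its data \<open>u\<close> (upper bound), \<open>l\<close> (lower bound) and \<open>D\<close> (domain).\<close>

definition is_corridor ::
  "('a::euclidean_space \<Rightarrow> real) \<Rightarrow> ('a \<Rightarrow> real) \<Rightarrow> 'a set \<Rightarrow> bool" where
  "is_corridor u l D \<longleftrightarrow>
     full_dim_polytope D \<and> continuous_on D u \<and> continuous_on D l \<and> (\<forall>x\<in>D. l x < u x)"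

text \<open>The pieces \<open>P i\<close> have to cover \<open>D\<close> but need not be contained in it.\<close>

definition pwl_function ::
  "nat \<Rightarrow> 'a::euclidean_space set \<Rightarrow> ('a \<Rightarrow> real) \<Rightarrow> bool" where
  "pwl_function n D g \<longleftrightarrow> n \<ge> 1 \<and>
     (\<exists>(P :: nat \<Rightarrow> 'a set) (f :: nat \<Rightarrow> 'a \<Rightarrow> real).
        (\<forall>i\<in>{1..n}. full_dim_polytope (P i) \<and> linear_function (f i)) \<and>
        D \<subseteq> (\<Union>i\<in>{1..n}. P i) \<and>
        disjoint_family_on (\<lambda>i. interior (P i)) {1..n} \<and>
        (\<forall>x\<in>D.
           (\<forall>i\<in>{1..n}. x \<in> interior (P i) \<longrightarrow> g x = f i x) \<and>
           ((\<exists>i\<in>{1..n}. x \<in> frontier (P i)) \<longrightarrow>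
              g x = Min {f i x | i. i \<in> {1..n} \<and> x \<in> P i})))"

text \<open>Optimal values are infima in \<^typ>\<open>enat\<close>: the minimum if there is a feasible solution,
  and \<open>\<infinity>\<close> otherwise.\<close>

definition CFP_value ::
  "('a::euclidean_space \<Rightarrow> real) \<Rightarrow> ('a \<Rightarrow> real) \<Rightarrow> 'a set \<Rightarrow> enat" where
  "CFP_value u l D =
     Inf {enat n | n. \<exists>g. pwl_function n D g \<and> (\<forall>x\<in>D. l x \<le> g x \<and> g x \<le> u x)}"

definition linearly_compatible ::
  "('a::euclidean_space \<Rightarrow> real) \<Rightarrow> ('a \<Rightarrow> real) \<Rightarrow> 'a set \<Rightarrow> 'a set \<Rightarrow> bool" where
  "linearly_compatible u l D s \<longleftrightarrow> finite s \<and> s \<subseteq> D \<and>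
     (\<exists>L. linear_function L \<and> (\<forall>x \<in> convex hull s. l x \<le> L x \<and> L x \<le> u x))"

definition R_value ::
  "('a::euclidean_space \<Rightarrow> real) \<Rightarrow> ('a \<Rightarrow> real) \<Rightarrow> 'a set \<Rightarrow> 'a set \<Rightarrow> enat" where
  "R_value u l D X =
     Inf {enat (card \<P>) | \<P>. partition_on X \<P> \<and> (\<forall>s\<in>\<P>. linearly_compatible u l D s)}"

end

theory Submission
  imports Defs
begin

text \<open>
  Given a feasible piecewise linear function with pieces \<open>P i\<close> carrying the affine functions \<open>f i\<close>,
  each point of \<open>X\<close> is sent to one piece that contains it. This splits \<open>X\<close> into at most \<open>n\<close> classes,
  and \<open>f i\<close> should witness that the class of \<open>P i\<close> is linearly compatible: its convex hull lies in
  the convex set \<open>D \<inter> P i\<close>, and \<open>f i\<close> equals the piecewise linear function, hence stays in the corridor,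
  at the points of \<open>D\<close> interior to \<open>P i\<close>.

  Two difficulties come from the boundaries. At a boundary point the value is a minimum over several
  pieces, so \<open>f i\<close> itself may differ from it; this is repaired by continuity
  (\<open>affine_piece_within_corridor\<close>), provided that \<open>D \<inter> P i\<close> is the closure of its interior. A piece
  that only touches \<open>D\<close> along the boundary escapes that argument, and there \<open>f i\<close> may really leave the
  corridor. Such pieces can be discarded, because the pieces whose interior meets the interior of \<open>D\<close>
  already cover \<open>D\<close> (\<open>pieces_meeting_interior_cover\<close>).
\<close>

lemma full_dim_polytope_convex_closed:
  assumes "full_dim_polytope S"
  shows "convex S" "closed S"
  using assms by (auto simp: full_dim_polytope_def polytope_imp_convex polytope_imp_closed)

lemma full_dim_polytope_closure_interior:
  fixes S :: "'a::euclidean_space set"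
  assumes "full_dim_polytope S"
  shows "closure (interior S) = S"
proof -
  have "affine hull S = UNIV"
    using assms by (simp add: full_dim_polytope_def aff_dim_eq_full)
  then have "rel_interior S = interior S"
    by (rule rel_interior_interior)
  then show ?thesis
    using convex_closure_rel_interior[of S] full_dim_polytope_convex_closed[OF assms]
    by simp
qed

text \<open>An open set that misses the interior of a full-dimensional polytope misses the whole polytope.
  So the pieces left out do not meet the interior of \<open>D\<close>, the others cover it, and their finite union,
  being closed, contains the closure of that interior, which is \<open>D\<close>.\<close>

lemma pieces_meeting_interior_cover:
  assumes D: "full_dim_polytope D"
    and P: "\<And>i. i \<in> I \<Longrightarrow> full_dim_polytope (P i)"
    and "finite I" and cover: "D \<subseteq> (\<Union>i\<in>I. P i)"
  shows "D \<subseteq> (\<Union>i\<in>{i\<in>I. interior D \<inter> interior (P i) \<noteq> {}}. P i)" (is "D \<subseteq> ?U")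
proof -
  have miss: "interior D \<inter> P i = {}" if "i \<in> I" "interior D \<inter> interior (P i) = {}" for i
    using that open_Int_closure_eq_empty[OF open_interior[of D], of "interior (P i)"]
      full_dim_polytope_closure_interior[OF P[OF \<open>i \<in> I\<close>]] by simp
  have "interior D \<subseteq> ?U"
  proof
    fix x assume x: "x \<in> interior D"
    then have "x \<in> D"
      using interior_subset by auto
    then obtain i where "i \<in> I" "x \<in> P i"
      using cover by auto
    with miss[of i] x show "x \<in> ?U" by auto
  qed
  moreover have "closed ?U"
    using \<open>finite I\<close> P by (intro closed_UN) (auto intro: full_dim_polytope_convex_closed)
  ultimately have "closure (interior D) \<subseteq> ?U"
    by (rule closure_minimal)
  then show ?thesis
    by (simp add: full_dim_polytope_closure_interior[OF D])
qed

text \<open>The convex set \<open>D \<inter> Q\<close> has an interior point, so it is the closure of its interior; a weak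
  inequality between continuous functions passes to this closure.\<close>

lemma affine_piece_within_corridor:
  assumes "is_corridor u l D" and Q: "full_dim_polytope Q" and "linear_function f"
    and meet: "interior D \<inter> interior Q \<noteq> {}"
    and bounds: "\<And>x. x \<in> D \<inter> interior Q \<Longrightarrow> l x \<le> f x \<and> f x \<le> u x"
    and x: "x \<in> D \<inter> Q"
  shows "l x \<le> f x \<and> f x \<le> u x"
proof -
  let ?S = "D \<inter> Q"
  have D: "full_dim_polytope D" and cont: "continuous_on D u" "continuous_on D l"
    using assms(1) by (auto simp: is_corridor_def)
  have "convex ?S" "closed ?S" "interior ?S \<noteq> {}"
    using full_dim_polytope_convex_closed[OF D] full_dim_polytope_convex_closed[OF Q] meet
    by (auto intro: convex_Int)
  then have cl: "closure (interior ?S) = ?S"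
    using convex_closure_interior[of ?S] by (metis closure_closed)
  obtain a b where f: "f = (\<lambda>x. a \<bullet> x + b)"
    using \<open>linear_function f\<close> by (auto simp: linear_function_def)
  have contf: "continuous_on ?S f"
    unfolding f by (intro continuous_intros)
  have cont': "continuous_on ?S u" "continuous_on ?S l"
    using cont by (auto intro: continuous_on_subset)
  have int: "l y \<le> f y \<and> f y \<le> u y" if "y \<in> interior ?S" for y
    using bounds[of y] that interior_subset[of D] by auto
  have "continuous_on (closure (interior ?S)) (\<lambda>y. f y - l y)"
    unfolding cl using contf cont'(2) by (rule continuous_on_diff)
  then have "f x - l x \<ge> 0"
    by (rule continuous_ge_on_closure) (use cl x int in auto)
  moreover have "continuous_on (closure (interior ?S)) (\<lambda>y. u y - f y)"
    unfolding cl using cont'(1) contf by (rule continuous_on_diff)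
  then have "u x - f x \<ge> 0"
    by (rule continuous_ge_on_closure) (use cl x int in auto)
  ultimately show ?thesis by simp
qed

lemma exists_compatible_partition:
  assumes corr: "is_corridor u l D" and "finite X" "X \<subseteq> D"
    and "pwl_function n D g" and g: "\<forall>x\<in>D. l x \<le> g x \<and> g x \<le> u x"
  shows "\<exists>\<P>. partition_on X \<P> \<and> (\<forall>s\<in>\<P>. linearly_compatible u l D s) \<and> card \<P> \<le> n"
proof -
  obtain P f where
    P: "\<And>i. i \<in> {1..n} \<Longrightarrow> full_dim_polytope (P i)"
    and f: "\<And>i. i \<in> {1..n} \<Longrightarrow> linear_function (f i)"
    and cover: "D \<subseteq> (\<Union>i\<in>{1..n}. P i)"
    and gf: "\<And>i x. \<lbrakk>i \<in> {1..n}; x \<in> D; x \<in> interior (P i)\<rbrakk> \<Longrightarrow> g x = f i x"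
    using \<open>pwl_function n D g\<close> unfolding pwl_function_def by blast
  have D: "full_dim_polytope D"
    using corr by (simp add: is_corridor_def)
  define J where "J = {i\<in>{1..n}. interior D \<inter> interior (P i) \<noteq> {}}"
  have "D \<subseteq> (\<Union>i\<in>J. P i)"
    unfolding J_def by (rule pieces_meeting_interior_cover[OF D P _ cover]) auto
  then have "\<forall>x\<in>X. \<exists>i\<in>J. x \<in> P i"
    using \<open>X \<subseteq> D\<close> by blast
  then obtain h where h: "\<And>x. x \<in> X \<Longrightarrow> h x \<in> J \<and> x \<in> P (h x)"
    by metis
  \<comment> \<open>Indexing the classes by \<open>h ` X\<close> instead of \<open>J\<close> excludes the empty class.\<close>
  define C where "C i = {x\<in>X. h x = i}" for i
  have "partition_on X (C ` h ` X)"
    by (rule partition_onI) (auto simp: C_def disjnt_def)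
  moreover have "linearly_compatible u l D (C i)" if "i \<in> h ` X" for i
  proof -
    have i: "i \<in> {1..n}" and meet: "interior D \<inter> interior (P i) \<noteq> {}"
      using h that by (auto simp: J_def)
    have "convex (D \<inter> P i)"
      using full_dim_polytope_convex_closed[OF D] full_dim_polytope_convex_closed[OF P[OF i]]
      by (simp add: convex_Int)
    moreover have "C i \<subseteq> D \<inter> P i"
      using h \<open>X \<subseteq> D\<close> by (auto simp: C_def)
    ultimately have hull: "convex hull C i \<subseteq> D \<inter> P i"
      by (intro hull_minimal)
    have "l x \<le> f i x \<and> f i x \<le> u x" if "x \<in> D \<inter> interior (P i)" for x
      using that g gf[OF i, of x] by auto
    then have "l x \<le> f i x \<and> f i x \<le> u x" if "x \<in> D \<inter> P i" for x
      using that by (rule affine_piece_within_corridor[OF corr P[OF i] f[OF i] meet])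
    then have "\<forall>x\<in>convex hull C i. l x \<le> f i x \<and> f i x \<le> u x"
      using hull by blast
    then show ?thesis
      using f[OF i] \<open>finite X\<close> \<open>X \<subseteq> D\<close> by (auto simp: linearly_compatible_def C_def)
  qed
  moreover have "card (C ` h ` X) \<le> n"
  proof -
    have "card (C ` h ` X) \<le> card (h ` X)"
      using \<open>finite X\<close> by (simp add: card_image_le)
    also have "\<dots> \<le> card {1..n}"
      using h by (intro card_mono) (auto simp: J_def)
    finally show ?thesis by simp
  qed
  ultimately show ?thesis by blast
qed

theorem proposition7:
  fixes u l :: "real ^ 'm \<Rightarrow> real" and D X :: "(real ^ 'm) set"
  assumes "is_corridor u l D"
    and "finite X" and "X \<subseteq> D"
  shows "R_value u l D X \<le> CFP_value u l D"
  unfolding CFP_value_def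
proof (rule Inf_greatest)
  fix v assume "v \<in> {enat n | n. \<exists>g. pwl_function n D g \<and> (\<forall>x\<in>D. l x \<le> g x \<and> g x \<le> u x)}"
  then obtain n g where v: "v = enat n"
    and "pwl_function n D g" "\<forall>x\<in>D. l x \<le> g x \<and> g x \<le> u x"
    by blast
  then obtain \<P> where "partition_on X \<P>" "\<forall>s\<in>\<P>. linearly_compatible u l D s" "card \<P> \<le> n"
    using exists_compatible_partition[OF assms] by blast
  then have "R_value u l D X \<le> enat (card \<P>)"
    unfolding R_value_def by (intro Inf_lower) blast
  also have "\<dots> \<le> v"
    using v \<open>card \<P> \<le> n\<close> by simp
  finally show "R_value u l D X \<le> v" .
qed

end
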